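(* Let $b(n)$ be a variable-$r$ meta-Fibonacci sequence generated by $r(n)$. Let $m=\liminf_{n\to\infty} r(n)$ and $M=\limsup_{n\to\infty} r(n)$, and suppose $M<\infty$. Then $b(n)$ is $\Omega\!\left(\left[1+\frac{m-1}{M}\right]^n\right)$; that is, there exist a constant $c>0$ and an integer $N$ such that $b(n)\ge c\left[1+\frac{m-1}{M}\right]^n$ for all $n\ge N$.
   Context: Let $\mathbb{N}$ be the non-negative integers and $\mathbb{Z}^+$ the positive integers. Let $r:\mathbb{N}\to\mathbb{Z}^+$ satisfy $r(0)=1$ and $r(n)\le n$ for all $n\ge 1$. The variable-$r$ meta-Fibonacci sequence generated by $r(n)$ is the sequence $b:\mathbb{N}\to\mathbb{Z}^+$ defined by $b(0)=1$ and $b(n)=\sum_{k=1}^{r(n)} b(n-k)$ for $n\ge 1$. *)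

theory Defs
  imports "HOL-Analysis.Analysis"
begin

definition meta_fib_generator :: "(nat \<Rightarrow> nat) \<Rightarrow> bool" where
  "meta_fib_generator r \<longleftrightarrow> (\<forall>n. r n > 0) \<and> r 0 = 1 \<and> (\<forall>n\<ge>1. r n \<le> n)"

text \<open>The recursion terminates for every \<open>r\<close>, but if \<open>r n > n\<close> the subtraction on \<^typ>\<open>nat\<close>
  truncates and the value is meaningless. The constant is intended only for \<open>r\<close> satisfying
  \<^const>\<open>meta_fib_generator\<close>.\<close>

fun meta_fib :: "(nat \<Rightarrow> nat) \<Rightarrow> nat \<Rightarrow> nat" where
  "meta_fib r 0 = 1"
| "meta_fib r (Suc n) = (\<Sum>k = 1..r (Suc n). meta_fib r (Suc n - k))"

lemma meta_fib_rec: "n \<ge> 1 \<Longrightarrow> meta_fib r n = (\<Sum>k = 1..r n. meta_fib r (n - k))"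
  by (cases n) simp_all

lemma meta_fib_pos:
  assumes "meta_fib_generator r"
  shows "meta_fib r n > 0"
proof (induction n rule: less_induct)
  case (less n)
  show ?case
  proof (cases "n = 0")
    case False
    have "0 < (\<Sum>k = 1..r n. meta_fib r (n - k))"
      using assms False by (intro sum_pos less.IH) (auto simp: meta_fib_generator_def Suc_le_eq)
    then show ?thesis
      using False by (simp add: meta_fib_rec)
  qed simp
qed

end

theory Submission
  imports Defs
begin

text \<open>
  Let \<open>p = \<lceil>m\<rceil>\<close>. From some index on \<open>r n > p - 1\<close>, hence \<open>r n \<ge> p\<close>, so \<open>b\<close> eventually
  dominates the \<open>p\<close>-bonacci recurrence \<open>b n \<ge> b (n - 1) + \<dots> + b (n - p)\<close>. An exponential \<open>x ^ n\<close>
  with \<open>x \<ge> 1\<close> is a subsolution of that recurrence as soon as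
  \<open>x ^ (n - 1) + \<dots> + x ^ (n - p) \<ge> x ^ n\<close>, which for \<open>x > 1\<close> amounts to \<open>x ^ p * (2 - x) \<ge> 1\<close>.
  The choice \<open>x = 2 - 1/p = 1 + (p - 1)/p\<close> qualifies: there \<open>2 - x = 1/p\<close>, and
  \<open>x ^ p \<ge> 1 + p * ((p - 1)/p) = p\<close> is Bernoulli's inequality
  (\<open>power_le_sum_preceding_powers\<close>). Induction then gives growth of order \<open>(2 - 1/p) ^ n\<close>
  (\<open>meta_fib_exponential_lower_bound\<close>).

  Because \<open>1 \<le> m \<le> M\<close> and \<open>m \<le> p\<close>, the base \<open>1 + (m - 1)/M\<close> is at most
  \<open>1 + (m - 1)/m = 2 - 1/m \<le> 2 - 1/p\<close>.
\<close>

lemma sum_preceding_powers: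
  fixes x :: "'a::comm_ring_1"
  assumes "p \<le> n"
  shows "(x - 1) * (\<Sum>k = 1..p. x ^ (n - k)) = x ^ n - x ^ (n - p)"
  using assms
proof (induction p)
  case (Suc p)
  have "x ^ (n - p) = x * x ^ (n - Suc p)"
    using Suc.prems by (simp flip: power_Suc add: Suc_diff_Suc)
  then show ?case
    using Suc by (simp add: algebra_simps)
qed simp

text \<open>The number \<open>2 - 1/p\<close> does not exceed the \<open>p\<close>-bonacci constant, the positive root of
  \<open>x ^ p = x ^ (p - 1) + \<dots> + 1\<close>.\<close>

lemma power_le_sum_preceding_powers:
  fixes n p :: nat
  defines "x \<equiv> 2 - 1 / real p"
  assumes "1 \<le> p" "p \<le> n"
  shows "x ^ n \<le> (\<Sum>k = 1..p. x ^ (n - k))"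
proof (cases "p = 1")
  \<comment> \<open>Here \<open>x = 1\<close>, so the factor \<open>x - 1\<close> of the telescoping identity cannot be cancelled.\<close>
  case True
  then show ?thesis by (simp add: x_def)
next
  case False
  then have p: "p \<ge> 2" using assms by simp
  have x: "x > 1" using p by (simp add: x_def)
  have "1 + real p * (1 - 1 / real p) \<le> (1 + (1 - 1 / real p)) ^ p"
    by (rule Bernoulli_inequality) (use p in \<open>simp add: divide_le_eq\<close>)
  then have "real p \<le> x ^ p"
    using p by (simp add: x_def right_diff_distrib)
  then have "1 \<le> (2 - x) * x ^ p"
    using p by (simp add: x_def field_simps)
  then have "x ^ (n - p) * 1 \<le> x ^ (n - p) * ((2 - x) * x ^ p)"
    using x by (intro mult_left_mono) auto
  also have "\<dots> = (2 - x) * x ^ n"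
    using \<open>p \<le> n\<close> by (simp add: mult.left_commute flip: power_add)
  finally have "(x - 1) * x ^ n \<le> x ^ n - x ^ (n - p)"
    by (simp add: algebra_simps)
  then have "(x - 1) * x ^ n \<le> (x - 1) * (\<Sum>k = 1..p. x ^ (n - k))"
    using sum_preceding_powers[OF \<open>p \<le> n\<close>, of x] by simp
  then show ?thesis
    using x by simp
qed

text \<open>The constant \<open>1 / x ^ N\<close> makes the bound at most \<open>1\<close> for every \<open>n \<le> N\<close>, where positivity of
  the integer \<open>meta_fib r n\<close> suffices; beyond \<open>N\<close> the recurrence propagates it.\<close>

lemma meta_fib_exponential_lower_bound:
  fixes p N :: nat
  defines "x \<equiv> 2 - 1 / real p"
  assumes gen: "meta_fib_generator r"
    and p: "1 \<le> p" and ge: "\<And>n. n \<ge> N \<Longrightarrow> p \<le> r n"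
  shows "x ^ n / x ^ N \<le> real (meta_fib r n)"
proof (induction n rule: less_induct)
  case (less n)
  have x: "x \<ge> 1" using p by (simp add: x_def)
  show ?case
  proof (cases "n \<le> N")
    case True
    then have "x ^ n / x ^ N \<le> 1"
      using x by (simp add: power_increasing)
    also have "1 \<le> real (meta_fib r n)"
      using meta_fib_pos[OF gen, of n] by simp
    finally show ?thesis .
  next
    case False
    then have "p \<le> r n" "r n \<le> n"
      using ge[of n] gen by (auto simp: meta_fib_generator_def)
    have "x ^ n \<le> (\<Sum>k = 1..p. x ^ (n - k))"
      unfolding x_def
      by (rule power_le_sum_preceding_powers) (use p \<open>p \<le> r n\<close> \<open>r n \<le> n\<close> in auto)
    then have "x ^ n / x ^ N \<le> (\<Sum>k = 1..p. x ^ (n - k)) / x ^ N"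
      using x by (intro divide_right_mono) auto
    also have "\<dots> = (\<Sum>k = 1..p. x ^ (n - k) / x ^ N)"
      by (rule sum_divide_distrib)
    also have "\<dots> \<le> (\<Sum>k = 1..p. real (meta_fib r (n - k)))"
      using False by (intro sum_mono less.IH) auto
    also have "\<dots> \<le> (\<Sum>k = 1..r n. real (meta_fib r (n - k)))"
      using \<open>p \<le> r n\<close> by (intro sum_mono2) auto
    also have "\<dots> = real (meta_fib r n)"
      using False by (simp add: meta_fib_rec)
    finally show ?thesis .
  qed
qed

theorem corollary2p15:
  fixes r b :: "nat \<Rightarrow> nat" and m M :: ereal
  assumes "meta_fib_generator r"
    and "b = meta_fib r"
    and "m = liminf (\<lambda>n. ereal (real (r n)))"
    and "M = limsup (\<lambda>n. ereal (real (r n)))"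
    and "M < \<infinity>"
  shows "\<exists>c>0. \<exists>N. \<forall>n\<ge>N.
    real (b n) \<ge> c * (1 + (real_of_ereal m - 1) / real_of_ereal M) ^ n"
proof -
  have "1 \<le> ereal (real (r n))" for n
    using assms(1) by (simp add: meta_fib_generator_def Suc_le_eq)
  then have "1 \<le> m"
    unfolding assms(3) by (intro Liminf_bounded always_eventually) auto
  have "m \<le> M"
    unfolding assms(3,4) by (rule Liminf_le_Limsup) simp
  obtain \<mu> M' where reals: "m = ereal \<mu>" "M = ereal M'"
    using \<open>1 \<le> m\<close> \<open>m \<le> M\<close> \<open>M < \<infinity>\<close> by (cases m; cases M) auto
  have \<mu>: "1 \<le> \<mu>" "\<mu> \<le> M'"
    using \<open>1 \<le> m\<close> \<open>m \<le> M\<close> reals by auto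

  define p where "p = nat \<lceil>\<mu>\<rceil>"
  have p: "1 \<le> p" "\<mu> \<le> real p" "real p - 1 < \<mu>"
    using \<mu> unfolding p_def by linarith+
  have "ereal (real p - 1) < liminf (\<lambda>n. ereal (real (r n)))"
    using p unfolding assms(3)[symmetric] reals by simp
  then have "eventually (\<lambda>n. ereal (real p - 1) < ereal (real (r n))) sequentially"
    by (rule less_LiminfD)
  then obtain N where N: "\<And>n. n \<ge> N \<Longrightarrow> real p - 1 < real (r n)"
    by (auto simp: eventually_sequentially)
  have ge: "p \<le> r n" if "n \<ge> N" for n
    using N[OF that] by linarith

  define x where "x = 2 - 1 / real p"
  have "x \<ge> 1" using p by (simp add: x_def)
  define y where "y = 1 + (\<mu> - 1) / M'"
  have "0 \<le> y" using \<mu> by (simp add: y_def)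
  have "(\<mu> - 1) / M' \<le> (\<mu> - 1) / \<mu>"
    using \<mu> by (intro divide_left_mono) auto
  also have "\<dots> = 1 - 1 / \<mu>"
    using \<mu> by (simp add: diff_divide_distrib)
  also have "\<dots> \<le> 1 - 1 / real p"
    using \<mu> p by (simp add: frac_le)
  finally have "y \<le> x" by (simp add: y_def x_def)

  have "1 / x ^ N * y ^ n \<le> real (b n)" for n
  proof -
    have "1 / x ^ N * y ^ n \<le> x ^ n / x ^ N"
      using \<open>x \<ge> 1\<close> \<open>0 \<le> y\<close> \<open>y \<le> x\<close> by (simp add: divide_right_mono power_mono)
    also have "\<dots> \<le> real (b n)"
      unfolding x_def assms(2)
      by (rule meta_fib_exponential_lower_bound[OF assms(1) p(1) ge])
    finally show ?thesis .
  qed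
  moreover have "1 / x ^ N > 0" using \<open>x \<ge> 1\<close> by simp
  ultimately show ?thesis
    unfolding reals y_def real_of_ereal.simps by blast
qed

end
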